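(* Let $k\ge 1$ be an integer, let $0\le t_1<\cdots<t_k<2\pi$, and extend these times $2\pi$-periodically, so that $t_{j+k}=t_j+2\pi$ for all $j$. Let $a>0$ be a constant. Let $p:\mathbb{R}\times\mathbb{R}\times\mathbb{R}\to\mathbb{R}$ be bounded, continuous and $2\pi$-periodic in its first variable. Let $g:\mathbb{R}\to\mathbb{R}$ be locally Lipschitz continuous, put $G(x)=\int_0^x g(s)\,ds$, and suppose that $$(g_0)\quad \lim_{|x|\to+\infty}\frac{g(x)}{x}=0,$$ $$(g_1)\quad \lim_{|x|\to+\infty} g(x)\,\mathrm{sign}(x)=+\infty,\qquad \lim_{x^+\to+\infty}\int_{x^-}^{x^+}\frac{ds}{\sqrt{G(x^+)-G(s)}}=+\infty,$$ where $x^-<0<x^+$ satisfy $G(x^-)=G(x^+)$. Then the impulsive differential equation $$x''(t)+g(x)=p(t,x,x'),\quad t\ne t_j;\qquad \Delta x|_{t=t_j}=a\,x(t_j-),\quad \Delta x'|_{t=t_j}=a\,x'(t_j-)\quad\text{for all } j,$$ has at least one $2\pi$-periodic solution.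
   Context: The index $j$ of the impulse times runs over all indices of the bi-infinite periodic sequence $(t_j)$. Notation: $\Delta x|_{t=t_j}=x(t_j+)-x(t_j-)$ and $\Delta x'|_{t=t_j}=x'(t_j+)-x'(t_j-)$, where $\pm$ denote one-sided limits. A solution satisfies the differential equation away from the impulse times and the jump conditions at the impulse times; by convention its values at $t_j$ are the left limits, $x(t_j)=x(t_j-)$ and $x'(t_j)=x'(t_j-)$. In $(g_1)$, for $x^+$ large, $x^-$ is the negative number with $G(x^-)=G(x^+)$ (unique for $x^+$ large because $G(x)\to+\infty$ as $|x|\to\infty$ and $g(x)\,\mathrm{sign}(x)>0$ for $|x|$ large). *)

theory Defs
  imports "HOL-Analysis.Analysis"
begin

text \<open>The interval integral is oriented, so that the primitive is the usual one for \<open>x < 0\<close> too.\<close>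

definition primitive :: "(real \<Rightarrow> real) \<Rightarrow> real \<Rightarrow> real" where
  "primitive g x = (LBINT s=0..x. g s)"

text \<open>The point \<open>x\<^sup>-\<close> associated with \<open>x\<^sup>+\<close>. It is meaningful only for \<open>x\<^sup>+\<close> large, where
  existence and uniqueness follow from the first limit in condition \<open>(g\<^sub>1)\<close>.\<close>

definition neg_partner :: "(real \<Rightarrow> real) \<Rightarrow> real \<Rightarrow> real" where
  "neg_partner g xp = (THE xm. xm < 0 \<and> primitive g xm = primitive g xp)"

text \<open>At the two endpoints the integrand is \<open>1 / 0 = 0\<close>, which does not affect the integral;
  for \<open>xp\<close> large the endpoint singularities are integrable and the radicand is positive
  in between.\<close>

definition time_integral :: "(real \<Rightarrow> real) \<Rightarrow> real \<Rightarrow> real" where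
  "time_integral g xp =
     integral {neg_partner g xp..xp} (\<lambda>s. 1 / sqrt (primitive g xp - primitive g s))"

definition cond_g0 :: "(real \<Rightarrow> real) \<Rightarrow> bool" where
  "cond_g0 g \<longleftrightarrow> ((\<lambda>x. g x / x) \<longlongrightarrow> 0) at_infinity"

definition cond_g1 :: "(real \<Rightarrow> real) \<Rightarrow> bool" where
  "cond_g1 g \<longleftrightarrow>
     filterlim (\<lambda>x. g x * sgn x) at_top at_infinity \<and>
     filterlim (time_integral g) at_top at_top"

text \<open>The one-sided limits exist, the value is the left limit, and \<open>\<Delta>f = a f(s-)\<close> at \<open>s\<close>.\<close>

definition linear_impulse :: "real \<Rightarrow> (real \<Rightarrow> real) \<Rightarrow> real \<Rightarrow> bool" where
  "linear_impulse a f s \<longleftrightarrow>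
     (\<exists>l r. (f \<longlongrightarrow> l) (at_left s) \<and> (f \<longlongrightarrow> r) (at_right s) \<and> f s = l \<and> r - l = a * l)"

text \<open>The function \<open>x'\<close> is the derivative of \<open>x\<close> away from the impulse times and its left limit at
  the impulse times; it is therefore determined by \<open>x\<close>.\<close>

definition impulsive_solution ::
  "(int \<Rightarrow> real) \<Rightarrow> real \<Rightarrow> (real \<Rightarrow> real) \<Rightarrow> (real \<Rightarrow> real \<Rightarrow> real \<Rightarrow> real) \<Rightarrow> (real \<Rightarrow> real) \<Rightarrow> bool" where
  "impulsive_solution \<tau> a g p x \<longleftrightarrow>
     (\<exists>x'. (\<forall>t. t \<notin> range \<tau> \<longrightarrow>
              (x has_real_derivative x' t) (at t) \<and>
              (\<exists>x''. (x' has_real_derivative x'') (at t) \<and> x'' + g (x t) = p t (x t) (x' t))) \<and>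
           (\<forall>j. linear_impulse a x (\<tau> j) \<and> linear_impulse a x' (\<tau> j)))"

end

theory Submission
  imports Defs "HOL-Complex_Analysis.Great_Picard"
begin

text \<open>Write \<open>\<mu> = (1 + a)\<^sup>k\<close> for the total amplification by the impulses of one period. The sublinearity
of \<open>g\<close> makes the equation a small perturbation, at large amplitude, of the free motion
\<open>x'' = 0\<close> with the same impulses. The impulses multiply the whole phase vector \<open>(x, x')\<close> by a
scalar, so the period map of the free motion is \<open>\<mu>\<close> times the shear \<open>(u, v) \<mapsto> (u + 2 \<pi> v, v)\<close>. Its
only eigenvalue \<open>\<mu>\<close> exceeds \<open>1\<close>; hence the fixed point equation of the perturbed period map can
be solved for its linear part, and what remains maps a large disc into itself.

Three devices turn this into a proof.

The impulses are removed by the substitution \<open>x t = b t * u t\<close>, where \<open>b t\<close> is the power of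
\<open>1 + a\<close> that counts the impulses since the beginning of the period. Then \<open>u\<close> and \<open>u'\<close> are
continuous, \<open>u'' = \<phi> t u u'\<close> with \<open>\<phi>\<close> continuous between impulses and sublinear in \<open>u\<close>, and
periodicity of \<open>x\<close> becomes \<open>u \<alpha> = \<mu> * u (\<alpha> + 2 * pi)\<close>, and the same for \<open>u'\<close>. The period is
taken to begin at an impulse time \<open>\<alpha>\<close>, so that the differential equation need not be checked
where the pieces are joined.

Since \<open>p\<close> is only continuous, initial value problems need not be uniquely solvable and
there is no period map. The boundary value problem is therefore solved first for the Euler
scheme with step \<open>2 \<pi> / (n + 1)\<close>, whose end point depends continuously on the initial vector. The
bound \<open>euler_growth\<close> and the comparison \<open>euler_near_free_motion\<close> hold uniformly in \<open>n\<close>,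
and Brouwer's theorem gives, for each \<open>n\<close>, an initial vector in one fixed disc.

The Euler polygons obtained in this way are equicontinuous, and by the Arzela-Ascoli theorem
a subsequence converges; \<open>euler_limit\<close> shows that the limit is a solution, which is the
statement \<open>sublinear_bvp\<close>. Undoing the substitution and extending periodically yields the
solution of the impulsive equation.\<close>

section \<open>Euler polygons and their limits\<close>

primrec euler :: "(real \<Rightarrow> 'a::real_normed_vector \<Rightarrow> 'a) \<Rightarrow> real \<Rightarrow> real \<Rightarrow> 'a \<Rightarrow> nat \<Rightarrow> 'a" where
  "euler F \<alpha> h w 0 = w"
| "euler F \<alpha> h w (Suc i) = euler F \<alpha> h w i + h *\<^sub>R F (\<alpha> + real i * h) (euler F \<alpha> h w i)"

text \<open>The broken line through the Euler points, in closed form: the coefficient of the \<open>i\<close>-th slope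
is the length of the part of the \<open>i\<close>-th step that lies before \<open>t\<close>, written as a difference so
that the coefficients telescope.\<close>

definition polygon ::
  "(real \<Rightarrow> 'a::real_normed_vector \<Rightarrow> 'a) \<Rightarrow> real \<Rightarrow> real \<Rightarrow> 'a \<Rightarrow> nat \<Rightarrow> real \<Rightarrow> 'a" where
  "polygon F \<alpha> h w m t =
     w + (\<Sum>i<m. (min t (\<alpha> + real (Suc i) * h) - min t (\<alpha> + real i * h))
                  *\<^sub>R F (\<alpha> + real i * h) (euler F \<alpha> h w i))"

lemma continuous_on_euler:
  assumes "\<And>t. continuous_on UNIV (F t)"
  shows "continuous_on S (\<lambda>w. euler F \<alpha> h w i)"
proof (induction i)
  case (Suc i)
  have "continuous_on S (\<lambda>w. F (\<alpha> + real i * h) (euler F \<alpha> h w i))"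
    by (rule continuous_on_compose2[OF assms Suc]) auto
  then show ?case
    using Suc by (auto intro!: continuous_intros)
qed (auto intro: continuous_intros)

text \<open>An increment of the polygon is a combination of the slopes met between \<open>s\<close> and \<open>t\<close>, with
nonnegative weights of total \<open>t - s\<close>. If all these slopes are within \<open>\<eta>\<close> of \<open>Y\<close>, so is the mean
slope. With \<open>Y = 0\<close> this is a Lipschitz bound, and with \<open>Y\<close> the value of the field at a point
of the limit it will give the derivative of the limit.\<close>

lemma polygon_slope:
  assumes h: "h \<ge> 0" and st: "\<alpha> \<le> s" "s \<le> t" "t \<le> \<alpha> + real m * h"
    and Y: "\<And>i. \<lbrakk>i < m; \<alpha> + real i * h < t; s < \<alpha> + real (Suc i) * h\<rbrakk>
                  \<Longrightarrow> norm (F (\<alpha> + real i * h) (euler F \<alpha> h w i) - Y) \<le> \<eta>"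
  shows "norm (polygon F \<alpha> h w m t - polygon F \<alpha> h w m s - (t - s) *\<^sub>R Y) \<le> \<eta> * (t - s)"
proof -
  define \<theta> where "\<theta> i = \<alpha> + real i * h" for i :: nat
  define d where "d i = (min t (\<theta> (Suc i)) - min t (\<theta> i)) - (min s (\<theta> (Suc i)) - min s (\<theta> i))" for i
  define v where "v i = F (\<theta> i) (euler F \<alpha> h w i)" for i
  have step: "\<theta> i \<le> \<theta> (Suc i)" for i
    using h by (simp add: \<theta>_def algebra_simps)
  have sum_d: "(\<Sum>i<m. d i) = t - s"
  proof -
    have "(\<Sum>i<m. d i) = (min t (\<theta> m) - min t (\<theta> 0)) - (min s (\<theta> m) - min s (\<theta> 0))"
      unfolding d_def sum_subtractf[of "\<lambda>i. min t (\<theta> (Suc i)) - min t (\<theta> i)"]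
      by (simp only: sum_lessThan_telescope[of "\<lambda>i. min t (\<theta> i)"]
          sum_lessThan_telescope[of "\<lambda>i. min s (\<theta> i)"])
    also have "\<dots> = t - s"
      using st by (simp add: \<theta>_def)
    finally show ?thesis .
  qed
  have diff: "polygon F \<alpha> h w m t - polygon F \<alpha> h w m s = (\<Sum>i<m. d i *\<^sub>R v i)"
    by (simp add: polygon_def d_def v_def \<theta>_def sum_subtractf[symmetric] scaleR_diff_left[symmetric])
  have "polygon F \<alpha> h w m t - polygon F \<alpha> h w m s - (t - s) *\<^sub>R Y = (\<Sum>i<m. d i *\<^sub>R (v i - Y))"
    unfolding diff by (simp add: sum_d[symmetric] scaleR_sum_left sum_subtractf scaleR_diff_right)
  also have "norm \<dots> \<le> (\<Sum>i<m. \<eta> * d i)"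
  proof (rule sum_norm_le)
    fix i assume i: "i \<in> {..<m}"
    have d0: "d i \<ge> 0"
      using step[of i] st by (auto simp: d_def min_def)
    show "norm (d i *\<^sub>R (v i - Y)) \<le> \<eta> * d i"
    proof (cases "\<theta> i < t \<and> s < \<theta> (Suc i)")
      case True
      then have "norm (v i - Y) \<le> \<eta>"
        using Y[of i] i by (simp add: v_def \<theta>_def)
      then show ?thesis
        using mult_left_mono[OF _ d0] d0 by (simp add: mult.commute[of \<eta>])
    next
      case False
      then have "d i = 0"
        using step[of i] st by (auto simp: d_def min_def)
      then show ?thesis by simp
    qed
  qed
  also have "\<dots> = \<eta> * (t - s)"
    by (simp add: sum_distrib_left[symmetric] sum_d)
  finally show ?thesis .
qed

lemma polygon_node:
  assumes h: "h > 0" and "j \<le> m"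
  shows "polygon F \<alpha> h w m (\<alpha> + real j * h) = euler F \<alpha> h w j"
  using \<open>j \<le> m\<close>
proof (induction j)
  case 0
  have "min \<alpha> (\<alpha> + real i * h) = \<alpha>" for i :: nat
    using h by simp
  then show ?case
    by (simp add: polygon_def del: of_nat_Suc)
next
  case (Suc j)
  let ?Y = "F (\<alpha> + real j * h) (euler F \<alpha> h w j)"
  let ?s = "\<alpha> + real j * h" and ?t = "\<alpha> + real (Suc j) * h"
  have "norm (polygon F \<alpha> h w m ?t - polygon F \<alpha> h w m ?s - (?t - ?s) *\<^sub>R ?Y) \<le> 0 * (?t - ?s)"
  proof (rule polygon_slope)
    fix i
    assume "\<alpha> + real i * h < ?t" "?s < \<alpha> + real (Suc i) * h"
    then have "i < Suc j" "j < Suc i"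
      using h by simp_all
    then have "i = j" by simp
    then show "norm (F (\<alpha> + real i * h) (euler F \<alpha> h w i) - ?Y) \<le> 0" by simp
  qed (use h Suc.prems in \<open>auto simp del: of_nat_Suc\<close>)
  then have "polygon F \<alpha> h w m ?t = polygon F \<alpha> h w m ?s + h *\<^sub>R ?Y"
    by (simp add: algebra_simps)
  then show ?case
    using Suc by simp
qed

text \<open>A Peano theorem without initial data: if the Euler points, with arbitrary initial points, stay in
a ball on which the field is bounded, then a subsequence of the polygons converges uniformly. The
limit solves the differential equation at each time where the field is continuous at the limit
point; only this local continuity enters the derivative, so that a field which jumps at the
impulse times is admitted.\<close>

lemma euler_limit:
  fixes F :: "real \<Rightarrow> 'a::euclidean_space \<Rightarrow> 'a" and w :: "nat \<Rightarrow> 'a"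
  assumes T: "T > 0"
    and R: "\<And>n i. i \<le> Suc n \<Longrightarrow> norm (euler F \<alpha> (T / Suc n) (w n) i) \<le> R"
    and K: "\<And>t y. norm y \<le> R \<Longrightarrow> norm (F t y) \<le> K"
  obtains W r where "continuous_on {\<alpha>..\<alpha> + T} W" "strict_mono (r :: nat \<Rightarrow> nat)"
    "(\<lambda>n. w (r n)) \<longlonglongrightarrow> W \<alpha>"
    "(\<lambda>n. euler F \<alpha> (T / Suc (r n)) (w (r n)) (Suc (r n))) \<longlonglongrightarrow> W (\<alpha> + T)"
    "\<And>t. \<lbrakk>\<alpha> < t; t < \<alpha> + T; isCont (\<lambda>(t, y). F t y) (t, W t)\<rbrakk>
      \<Longrightarrow> (W has_vector_derivative F t (W t)) (at t)"
proof -
  define h where "h n = T / Suc n" for n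
  define e where "e n = euler F \<alpha> (h n) (w n)" for n
  define P where "P n = polygon F \<alpha> (h n) (w n) (Suc n)" for n
  define S where "S = {\<alpha>..\<alpha> + T}"
  have h0: "h n > 0" for n
    using T by (simp add: h_def)
  have hT: "real (Suc n) * h n = T" for n
    by (simp add: h_def field_simps)
  have e_bd: "norm (e n i) \<le> R" if "i \<le> Suc n" for n i
    using R[OF that] by (simp add: e_def h_def)
  have node: "P n (\<alpha> + real i * h n) = e n i" if "i \<le> Suc n" for n i
    unfolding P_def e_def by (rule polygon_node[OF h0 that])
  have K0: "K \<ge> 0"
    using K[OF e_bd[of 0 0]] norm_ge_zero order_trans by blast
  have slope: "norm (P n t - P n s - (t - s) *\<^sub>R Y) \<le> \<eta> * (t - s)"
    if "s \<in> S" "t \<in> S" "s \<le> t"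
      "\<And>i. \<lbrakk>i < Suc n; \<alpha> + real i * h n < t; s < \<alpha> + real i * h n + h n\<rbrakk>
         \<Longrightarrow> norm (F (\<alpha> + real i * h n) (e n i) - Y) \<le> \<eta>" for n s t Y \<eta>
    unfolding P_def
  proof (rule polygon_slope)
    show "norm (F (\<alpha> + real i * h n) (euler F \<alpha> (h n) (w n) i) - Y) \<le> \<eta>"
      if "i < Suc n" "\<alpha> + real i * h n < t" "s < \<alpha> + real (Suc i) * h n" for i
      using \<open>\<And>i. \<lbrakk>i < Suc n; \<alpha> + real i * h n < t; s < \<alpha> + real i * h n + h n\<rbrakk>
         \<Longrightarrow> norm (F (\<alpha> + real i * h n) (e n i) - Y) \<le> \<eta>\<close>[of i] that
      by (simp add: e_def algebra_simps)
  qed (use that h0[of n] hT[of n] in \<open>auto simp: S_def\<close>)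
  have lip_le: "norm (P n t - P n s) \<le> K * (t - s)" if "s \<in> S" "t \<in> S" "s \<le> t" for n s t
    using slope[OF that, of n 0 K] K e_bd by simp
  have lip: "norm (P n s - P n t) \<le> K * \<bar>s - t\<bar>" if "s \<in> S" "t \<in> S" for n s t
    using lip_le[of s t n] lip_le[of t s n] that by (cases "s \<le> t") (auto simp: norm_minus_commute)
  have bd: "norm (P n t) \<le> R + K * T" if "t \<in> S" for n t
  proof -
    have "\<alpha> \<in> S" using T by (simp add: S_def)
    then have "norm (P n t - P n \<alpha>) \<le> K * \<bar>t - \<alpha>\<bar>"
      using lip that by blast
    also have "\<dots> \<le> K * T"
      using that K0 by (intro mult_left_mono) (auto simp: S_def)
    finally have "norm (P n t - P n \<alpha>) \<le> K * T" .
    moreover have "norm (P n \<alpha>) \<le> R"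
      using node[of 0 n] e_bd[of 0 n] by simp
    ultimately show ?thesis
      using norm_triangle_sub[of "P n t" "P n \<alpha>"] by linarith
  qed
  have equi: "\<exists>d>0. \<forall>n y. y \<in> S \<and> norm (x - y) < d \<longrightarrow> norm (P n x - P n y) < \<epsilon>"
    if "x \<in> S" "\<epsilon> > 0" for x \<epsilon>
  proof (intro exI conjI allI impI)
    show "\<epsilon> / (K + 1) > 0" using that K0 by simp
    fix n y assume y: "y \<in> S \<and> norm (x - y) < \<epsilon> / (K + 1)"
    have "norm (P n x - P n y) \<le> K * \<bar>x - y\<bar>"
      using lip that y by blast
    also have "\<dots> \<le> (K + 1) * \<bar>x - y\<bar>"
      by (intro mult_right_mono) auto
    also have "\<dots> < \<epsilon>"
      using y K0 by (simp add: pos_less_divide_eq mult.commute)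
    finally show "norm (P n x - P n y) < \<epsilon>" .
  qed
  have "compact S" by (simp add: S_def)
  then obtain W r where W: "continuous_on S W" and r: "strict_mono (r :: nat \<Rightarrow> nat)"
    and unif: "\<And>\<epsilon>. 0 < \<epsilon> \<Longrightarrow> \<exists>N. \<forall>n x. n \<ge> N \<and> x \<in> S \<longrightarrow> norm (P (r n) x - W x) < \<epsilon>"
    using Arzela_Ascoli[of S P, OF _ bd equi] by metis
  have conv: "(\<lambda>n. P (r n) x) \<longlonglongrightarrow> W x" if "x \<in> S" for x
    using unif that unfolding LIMSEQ_iff by blast
  have h_lim: "(\<lambda>n. h (r n)) \<longlonglongrightarrow> 0"
  proof -
    have "h \<longlonglongrightarrow> 0"
      unfolding h_def by (rule LIMSEQ_Suc[OF lim_const_over_n])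
    then show ?thesis
      using LIMSEQ_subseq_LIMSEQ[OF _ r] by (auto simp: o_def)
  qed
  have deriv: "(W has_vector_derivative F t (W t)) (at t)"
    if t: "\<alpha> < t" "t < \<alpha> + T" and cont: "isCont (\<lambda>(t, y). F t y) (t, W t)" for t
  proof -
    let ?Y = "F t (W t)"
    \<comment> \<open>Before passing to the limit, all slopes used near \<open>t\<close> are within \<open>\<eta>\<close> of the field at \<open>(t, W t)\<close>.\<close>
    have key: "\<exists>\<delta>>0. \<forall>s s'. \<bar>s - t\<bar> < \<delta> \<longrightarrow> \<bar>s' - t\<bar> < \<delta> \<longrightarrow> s \<le> s' \<longrightarrow>
        norm (W s' - W s - (s' - s) *\<^sub>R ?Y) \<le> \<eta> * (s' - s)" if \<eta>: "\<eta> > 0" for \<eta>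
    proof -
      obtain d where d: "d > 0"
        "\<And>z. dist z (t, W t) < d \<Longrightarrow> dist ((\<lambda>(t, y). F t y) z) ((\<lambda>(t, y). F t y) (t, W t)) < \<eta>"
        using cont \<eta> unfolding continuous_at_eps_delta by (metis (no_types))
      have Fd: "norm (F t' y - ?Y) \<le> \<eta>" if "\<bar>t' - t\<bar> < d / 2" "norm (y - W t) < d / 2" for t' y
      proof -
        have "dist (t', y) (t, W t) \<le> dist t' t + dist y (W t)"
          unfolding dist_Pair_Pair by (rule sqrt_sum_squares_le_sum) auto
        then have "dist (t', y) (t, W t) < d"
          using that by (simp add: dist_norm)
        from d(2)[OF this] show ?thesis
          by (simp add: dist_norm)
      qed
      have "t \<in> S" using t by (simp add: S_def)
      then obtain d1 where d1: "d1 > 0"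
        "\<And>x. x \<in> S \<Longrightarrow> dist x t < d1 \<Longrightarrow> dist (W x) (W t) < d / 4"
        using W d(1) unfolding continuous_on_iff by (metis zero_less_divide_iff zero_less_numeral)
      \<comment> \<open>A step that meets the \<open>\<delta>\<close>-neighbourhood of \<open>t\<close> begins within \<open>2 * \<delta>\<close> of \<open>t\<close> once it is short.\<close>
      define \<delta> where "\<delta> = min (min (d / 4) (d1 / 2)) (min (t - \<alpha>) (\<alpha> + T - t))"
      have \<delta>: "\<delta> > 0" "\<delta> \<le> d / 4" "\<delta> \<le> d1 / 2" "\<delta> \<le> t - \<alpha>" "\<delta> \<le> \<alpha> + T - t"
        using d(1) d1(1) t by (auto simp: \<delta>_def min_def)
      have "norm (W s' - W s - (s' - s) *\<^sub>R ?Y) \<le> \<eta> * (s' - s)"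
        if s: "\<bar>s - t\<bar> < \<delta>" "\<bar>s' - t\<bar> < \<delta>" "s \<le> s'" for s s'
      proof -
        have sS: "s \<in> S" "s' \<in> S"
          using s \<delta> unfolding S_def by auto
        obtain N where N: "\<And>n x. n \<ge> N \<Longrightarrow> x \<in> S \<Longrightarrow> norm (P (r n) x - W x) < d / 4"
          using unif[of "d / 4"] d(1) by auto
        have "\<forall>\<^sub>F n in sequentially. h (r n) < \<delta>"
          using order_tendstoD(2)[OF h_lim \<delta>(1)] .
        then have ev: "\<forall>\<^sub>F n in sequentially.
           norm (P (r n) s' - P (r n) s - (s' - s) *\<^sub>R ?Y) \<le> \<eta> * (s' - s)"
          using eventually_ge_at_top[of N]
        proof eventually_elim
          case (elim n)
          show ?case
          proof (rule slope[OF sS \<open>s \<le> s'\<close>])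
            fix i
            let ?x = "\<alpha> + real i * h (r n)"
            assume i: "i < Suc (r n)" "?x < s'" "s < ?x + h (r n)"
            have x: "\<bar>?x - t\<bar> < 2 * \<delta>"
              using i s elim by (auto simp: abs_less_iff)
            have xS: "?x \<in> S"
              using i(2) sS h0[of "r n"] by (auto simp: S_def)
            have "norm (P (r n) ?x - W ?x) < d / 4"
              using N elim xS by blast
            moreover have "norm (W ?x - W t) < d / 4"
              using d1(2)[OF xS] x \<delta> by (auto simp: dist_norm)
            ultimately have "norm (P (r n) ?x - W t) < d / 2"
              using norm_triangle_ineq[of "P (r n) ?x - W ?x" "W ?x - W t"] by simp
            then have "norm (e (r n) i - W t) < d / 2"
              using node[of i "r n"] i(1) by simp
            then show "norm (F ?x (e (r n) i) - ?Y) \<le> \<eta>"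
              using Fd x \<delta> by simp
          qed
        qed
        have "(\<lambda>n. norm (P (r n) s' - P (r n) s - (s' - s) *\<^sub>R ?Y))
                \<longlonglongrightarrow> norm (W s' - W s - (s' - s) *\<^sub>R ?Y)"
          by (intro tendsto_intros conv sS)
        from tendsto_upperbound[OF this ev] show ?thesis by simp
      qed
      then show ?thesis using \<delta>(1) by blast
    qed
    show ?thesis
      unfolding has_vector_derivative_def has_derivative_at_alt
    proof (intro conjI allI impI)
      show "bounded_linear (\<lambda>x. x *\<^sub>R ?Y)" by (rule bounded_linear_scaleR_left)
      fix \<eta> :: real assume "\<eta> > 0"
      then obtain \<delta> where \<delta>: "\<delta> > 0" "\<And>s s'. \<bar>s - t\<bar> < \<delta> \<Longrightarrow> \<bar>s' - t\<bar> < \<delta> \<Longrightarrow> s \<le> s' \<Longrightarrow>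
        norm (W s' - W s - (s' - s) *\<^sub>R ?Y) \<le> \<eta> * (s' - s)"
        using key by metis
      have "norm (W y - W t - (y - t) *\<^sub>R ?Y) \<le> \<eta> * norm (y - t)" if y: "norm (y - t) < \<delta>" for y
      proof (cases "t \<le> y")
        case True
        then show ?thesis using \<delta>(2)[of t y] \<delta>(1) y by simp
      next
        case False
        have "W y - W t - (y - t) *\<^sub>R ?Y = - (W t - W y - (t - y) *\<^sub>R ?Y)"
          by (simp add: algebra_simps)
        then have "norm (W y - W t - (y - t) *\<^sub>R ?Y) = norm (W t - W y - (t - y) *\<^sub>R ?Y)"
          by (simp only: norm_minus_cancel)
        then show ?thesis
          using \<delta>(2)[of y t] \<delta>(1) y False by simp
      qed
      then show "\<exists>d>0. \<forall>y. norm (y - t) < d \<longrightarrow>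
        norm (W y - W t - (y - t) *\<^sub>R ?Y) \<le> \<eta> * norm (y - t)"
        using \<delta>(1) by blast
    qed
  qed
  have "(\<lambda>n. w (r n)) \<longlonglongrightarrow> W \<alpha>"
    using conv[of \<alpha>] T node[of 0] by (simp add: S_def e_def)
  moreover have "(\<lambda>n. e (r n) (Suc (r n))) \<longlonglongrightarrow> W (\<alpha> + T)"
    using conv[of "\<alpha> + T"] T node[of "Suc (r n)" "r n" for n] unfolding hT by (simp add: S_def)
  ultimately show ?thesis
    using that[of W r] W r deriv by (simp add: S_def e_def h_def)
qed

section \<open>A boundary value problem with a sublinear force\<close>

definition phase_field :: "(real \<Rightarrow> real \<Rightarrow> real \<Rightarrow> real) \<Rightarrow> real \<Rightarrow> real \<times> real \<Rightarrow> real \<times> real" where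
  "phase_field \<phi> t w = (snd w, \<phi> t (fst w) (snd w))"

lemma euler_phase_field_Suc:
  "fst (euler (phase_field \<phi>) \<alpha> h w (Suc i)) =
     fst (euler (phase_field \<phi>) \<alpha> h w i) + h * snd (euler (phase_field \<phi>) \<alpha> h w i)"
  "snd (euler (phase_field \<phi>) \<alpha> h w (Suc i)) =
     snd (euler (phase_field \<phi>) \<alpha> h w i) + h * \<phi> (\<alpha> + real i * h)
       (fst (euler (phase_field \<phi>) \<alpha> h w i)) (snd (euler (phase_field \<phi>) \<alpha> h w i))"
  by (simp_all add: phase_field_def)

lemma abs_fst_snd_le_norm:
  fixes w :: "real \<times> real"
  shows "\<bar>fst w\<bar> \<le> norm w" "\<bar>snd w\<bar> \<le> norm w" "norm w \<le> \<bar>fst w\<bar> + \<bar>snd w\<bar>"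
  using norm_fst_le[of "fst w" "snd w"] norm_snd_le[of "snd w" "fst w"]
    norm_Pair_le[of "fst w" "snd w"] by auto

lemma norm_phase_field_le:
  assumes "\<epsilon> \<le> 1" and "\<And>t u v. \<bar>\<phi> t u v\<bar> \<le> \<epsilon> * \<bar>u\<bar> + C"
  shows "norm (phase_field \<phi> t w) \<le> 2 * norm w + C"
proof -
  have "norm (phase_field \<phi> t w) \<le> \<bar>snd w\<bar> + \<bar>\<phi> t (fst w) (snd w)\<bar>"
    using abs_fst_snd_le_norm(3)[of "phase_field \<phi> t w"] by (simp add: phase_field_def)
  also have "\<dots> \<le> norm w + (1 * norm w + C)"
  proof (rule add_mono[OF abs_fst_snd_le_norm(2)])
    have "\<epsilon> * \<bar>fst w\<bar> \<le> 1 * norm w"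
      using assms(1) by (rule order_trans[OF mult_right_mono]) (simp_all add: abs_fst_snd_le_norm)
    then show "\<bar>\<phi> t (fst w) (snd w)\<bar> \<le> 1 * norm w + C"
      using assms(2)[of t "fst w" "snd w"] by linarith
  qed
  finally show ?thesis by simp
qed

text \<open>A discrete Gronwall inequality; the bound does not depend on the step size for a fixed time
\<open>i * h\<close>.\<close>

lemma euler_growth:
  assumes F: "\<And>t y. norm (F t y) \<le> 2 * norm y + C" and "h \<ge> 0" "C \<ge> 0"
  shows "norm (euler F \<alpha> h w i) + C \<le> exp (2 * (real i * h)) * (norm w + C)"
proof (induction i)
  case (Suc i)
  let ?e = "euler F \<alpha> h w i"
  have "norm (euler F \<alpha> h w (Suc i)) \<le> norm ?e + h * norm (F (\<alpha> + real i * h) ?e)"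
    using \<open>h \<ge> 0\<close> norm_triangle_ineq[of ?e "h *\<^sub>R F (\<alpha> + real i * h) ?e"] by simp
  also have "\<dots> \<le> norm ?e + h * (2 * norm ?e + C)"
    using F \<open>h \<ge> 0\<close> by (intro add_left_mono mult_left_mono)
  also have "\<dots> + C \<le> (1 + 2 * h) * (norm ?e + C)"
    using \<open>h \<ge> 0\<close> \<open>C \<ge> 0\<close> by (simp add: algebra_simps)
  also have "\<dots> \<le> exp (2 * h) * (norm ?e + C)"
    using exp_ge_add_one_self[of "2 * h"] \<open>C \<ge> 0\<close> by (intro mult_right_mono) auto
  also have "\<dots> \<le> exp (2 * h) * (exp (2 * (real i * h)) * (norm w + C))"
    using Suc by (intro mult_left_mono) auto
  also have "\<dots> = exp (2 * (real (Suc i) * h)) * (norm w + C)"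
    by (simp add: distrib_left distrib_right exp_add)
  finally show ?case by simp
qed simp

text \<open>The bound \<open>\<rho>\<close> on the force along the scheme controls the deviation from uniform motion. The
free Euler scheme is exact, because the matrix of \<open>u' = v, v' = 0\<close> is nilpotent; hence no
discretisation error appears.\<close>

lemma euler_near_free_motion:
  fixes \<phi> :: "real \<Rightarrow> real \<Rightarrow> real \<Rightarrow> real"
  defines "F \<equiv> phase_field \<phi>"
  assumes h: "h \<ge> 0" and m: "real m * h \<le> T"
    and \<rho>: "\<And>i. i < m \<Longrightarrow>
      \<bar>\<phi> (\<alpha> + real i * h) (fst (euler F \<alpha> h w i)) (snd (euler F \<alpha> h w i))\<bar> \<le> \<rho>"
    and "i \<le> m"
  shows "\<bar>snd (euler F \<alpha> h w i) - snd w\<bar> \<le> real i * h * \<rho> \<and>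
         \<bar>fst (euler F \<alpha> h w i) - fst w - real i * h * snd w\<bar> \<le> real i * h * (T * \<rho>)"
  using \<open>i \<le> m\<close>
proof (induction i)
  case (Suc i)
  let ?e = "euler F \<alpha> h w"
  have \<rho>i: "\<bar>\<phi> (\<alpha> + real i * h) (fst (?e i)) (snd (?e i))\<bar> \<le> \<rho>"
    using \<rho>[of i] Suc.prems by simp
  have \<rho>0: "\<rho> \<ge> 0" using \<rho>i by linarith
  have ihT: "real i * h \<le> T"
    using Suc.prems m mult_right_mono[of "real i" "real m" h] h by simp
  have v: "\<bar>snd (?e i) - snd w\<bar> \<le> real i * h * \<rho>"
    and u: "\<bar>fst (?e i) - fst w - real i * h * snd w\<bar> \<le> real i * h * (T * \<rho>)"
    using Suc by simp_all
  have vT: "\<bar>snd (?e i) - snd w\<bar> \<le> T * \<rho>"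
    using v mult_right_mono[OF ihT \<rho>0] by linarith
  have "snd (?e (Suc i)) - snd w =
      (snd (?e i) - snd w) + h * \<phi> (\<alpha> + real i * h) (fst (?e i)) (snd (?e i))"
    unfolding F_def euler_phase_field_Suc by simp
  then have "\<bar>snd (?e (Suc i)) - snd w\<bar> \<le>
      \<bar>snd (?e i) - snd w\<bar> + h * \<bar>\<phi> (\<alpha> + real i * h) (fst (?e i)) (snd (?e i))\<bar>"
    using abs_triangle_ineq h by (metis abs_mult abs_of_nonneg)
  also have "\<dots> \<le> real i * h * \<rho> + h * \<rho>"
    using v \<rho>i h by (intro add_mono mult_left_mono)
  finally have 1: "\<bar>snd (?e (Suc i)) - snd w\<bar> \<le> real (Suc i) * h * \<rho>"
    by (simp add: algebra_simps)
  have "fst (?e (Suc i)) - fst w - real (Suc i) * h * snd w =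
      (fst (?e i) - fst w - real i * h * snd w) + h * (snd (?e i) - snd w)"
    unfolding F_def euler_phase_field_Suc by (simp add: algebra_simps)
  then have "\<bar>fst (?e (Suc i)) - fst w - real (Suc i) * h * snd w\<bar> \<le>
      \<bar>fst (?e i) - fst w - real i * h * snd w\<bar> + h * \<bar>snd (?e i) - snd w\<bar>"
    using abs_triangle_ineq h by (metis abs_mult abs_of_nonneg)
  also have "\<dots> \<le> real i * h * (T * \<rho>) + h * (T * \<rho>)"
    using u vT h by (intro add_mono mult_left_mono)
  finally have "\<bar>fst (?e (Suc i)) - fst w - real (Suc i) * h * snd w\<bar> \<le> real (Suc i) * h * (T * \<rho>)"
    by (simp add: algebra_simps)
  with 1 show ?case by simp
qed simp

text \<open>Let \<open>(du, dv)\<close> be the deviation of the end point of the scheme from the free motion started at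
\<open>(u, v)\<close>. The discrete boundary condition reads \<open>v = \<mu> * (v + dv)\<close> and
\<open>u = \<mu> * (u + T * v + du)\<close>, and as \<open>\<mu> \<noteq> 1\<close> it is equivalent to \<open>v = \<kappa> * dv\<close> and
\<open>u = \<kappa> * (T * v + du)\<close> with \<open>\<kappa> = \<mu> / (1 - \<mu>)\<close>. In this form the right-hand side is of the size
of the force, which sublinearity makes small relative to \<open>(u, v)\<close>, so that Brouwer's theorem
applies on a large disc.\<close>

lemma sublinear_bvp:
  fixes \<phi> :: "real \<Rightarrow> real \<Rightarrow> real \<Rightarrow> real"
  assumes T: "T > 0" and \<mu>: "\<mu> \<noteq> 1"
    and cont: "\<And>t. continuous_on UNIV (\<lambda>w. \<phi> t (fst w) (snd w))"
    and sublinear: "\<And>\<epsilon>. \<epsilon> > 0 \<Longrightarrow> \<exists>C. \<forall>t u v. \<bar>\<phi> t u v\<bar> \<le> \<epsilon> * \<bar>u\<bar> + C"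
  shows "\<exists>u v. continuous_on {\<alpha>..\<alpha> + T} u \<and> continuous_on {\<alpha>..\<alpha> + T} v \<and>
    u \<alpha> = \<mu> * u (\<alpha> + T) \<and> v \<alpha> = \<mu> * v (\<alpha> + T) \<and>
    (\<forall>t\<in>{\<alpha><..<\<alpha> + T}. isCont (\<lambda>(t, u, v). \<phi> t u v) (t, u t, v t) \<longrightarrow>
      (u has_real_derivative v t) (at t) \<and> (v has_real_derivative \<phi> t (u t) (v t)) (at t))"
proof -
  define F where "F = phase_field \<phi>"
  define \<kappa> where "\<kappa> = \<mu> / (1 - \<mu>)"
  define M where "M = exp (2 * T)"
  \<comment> \<open>A force bounded by \<open>\<rho>\<close> gives a right-hand side of norm at most \<open>D * \<rho>\<close>.\<close>
  define D where "D = \<bar>\<kappa>\<bar> * T + \<bar>\<kappa>\<bar> * (T * (\<bar>\<kappa>\<bar> * T) + T * T)"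
  define \<epsilon> where "\<epsilon> = min 1 (1 / (2 * D * M + 1))"
  have M: "M \<ge> 1" using T by (simp add: M_def)
  have D: "D \<ge> 0" using T by (simp add: D_def)
  have \<epsilon>: "\<epsilon> > 0" "\<epsilon> \<le> 1" "D * (\<epsilon> * M) \<le> 1 / 2"
  proof -
    have pos: "2 * D * M + 1 > 0" using M D by (simp add: add_nonneg_pos)
    then show "\<epsilon> > 0" "\<epsilon> \<le> 1" by (simp_all add: \<epsilon>_def)
    have "\<epsilon> \<le> 1 / (2 * D * M + 1)" by (simp add: \<epsilon>_def)
    then have "\<epsilon> * (2 * D * M + 1) \<le> 1" using pos by (simp add: pos_le_divide_eq)
    then show "D * (\<epsilon> * M) \<le> 1 / 2" using \<open>\<epsilon> > 0\<close> by (simp add: algebra_simps)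
  qed
  obtain C where C: "C \<ge> 0" "\<And>t u v. \<bar>\<phi> t u v\<bar> \<le> \<epsilon> * \<bar>u\<bar> + C"
  proof -
    obtain C0 where "\<And>t u v. \<bar>\<phi> t u v\<bar> \<le> \<epsilon> * \<bar>u\<bar> + C0"
      using sublinear[OF \<epsilon>(1)] by blast
    then have "\<bar>\<phi> t u v\<bar> \<le> \<epsilon> * \<bar>u\<bar> + max 0 C0" for t u v
      by (rule order_trans) simp
    then show ?thesis using that[of "max 0 C0"] by simp
  qed
  \<comment> \<open>The smallness \<open>D * \<epsilon> * M \<le> 1 / 2\<close> leaves half of \<open>R0\<close> for the terms that do not depend on \<open>R0\<close>.\<close>
  define R0 where "R0 = 2 * (D * (\<epsilon> * M * C + C)) + 1"
  have R0: "R0 > 0"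
    using D \<epsilon> M C by (simp add: R0_def add_nonneg_pos)
  define \<rho> where "\<rho> = \<epsilon> * (M * (R0 + C)) + C"
  have \<rho>0: "\<rho> \<ge> 0" using \<epsilon> M R0 C by (simp add: \<rho>_def)
  have D\<rho>: "D * \<rho> \<le> R0"
  proof -
    have "D * \<rho> = D * (\<epsilon> * M) * R0 + D * (\<epsilon> * M * C + C)"
      by (simp add: \<rho>_def algebra_simps)
    also have "\<dots> \<le> 1 / 2 * R0 + D * (\<epsilon> * M * C + C)"
      using \<epsilon>(3) R0 by (intro add_right_mono mult_right_mono) auto
    also have "\<dots> \<le> R0" by (simp add: R0_def)
    finally show ?thesis .
  qed
  define h where "h n = T / Suc n" for n
  have h0: "h n > 0" and hT: "real (Suc n) * h n = T" for n
    using T by (simp_all add: h_def field_simps)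
  have F_bd: "norm (F t y) \<le> 2 * norm y + C" for t y
    unfolding F_def using \<epsilon>(2) C(2) by (rule norm_phase_field_le)
  have F_cont: "continuous_on UNIV (F t)" for t
    unfolding F_def phase_field_def by (intro continuous_intros cont)
  have e_bd: "norm (euler F \<alpha> (h n) w i) \<le> M * (R0 + C)"
    if "norm w \<le> R0" "i \<le> Suc n" for n w i
  proof -
    have "real i * h n \<le> real (Suc n) * h n"
      using that h0[of n] by (intro mult_right_mono) auto
    then have "real i * h n \<le> T"
      unfolding hT .
    then have "exp (2 * (real i * h n)) * (norm w + C) \<le> M * (R0 + C)"
      using that C M unfolding M_def by (intro mult_mono) auto
    then show ?thesis
      using euler_growth[of F C "h n" \<alpha> w i] F_bd h0[of n] C(1) by simp
  qed
  have "\<exists>w. norm w \<le> R0 \<and> w = \<mu> *\<^sub>R euler F \<alpha> (h n) w (Suc n)" for n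
  proof -
    define e where "e w = euler F \<alpha> (h n) w (Suc n)" for w
    define V where "V w = \<kappa> * (snd (e w) - snd w)" for w
    define U where "U w = \<kappa> * (T * V w + (fst (e w) - fst w - T * snd w))" for w
    have e_cont: "continuous_on (cball 0 R0) e"
      unfolding e_def by (rule continuous_on_euler[OF F_cont])
    have "continuous_on (cball 0 R0) (\<lambda>w. (U w, V w))"
      unfolding U_def V_def by (intro continuous_intros e_cont)
    moreover have "(\<lambda>w. (U w, V w)) \<in> cball 0 R0 \<rightarrow> cball 0 R0"
    proof
      fix w :: "real \<times> real" assume "w \<in> cball 0 R0"
      then have w: "norm w \<le> R0" by simp
      have "\<bar>snd (e w) - snd w\<bar> \<le> real (Suc n) * h n * \<rho> \<and>
            \<bar>fst (e w) - fst w - real (Suc n) * h n * snd w\<bar> \<le> real (Suc n) * h n * (T * \<rho>)"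
        unfolding e_def F_def
      proof (rule euler_near_free_motion[of _ "Suc n"])
        fix i assume "i < Suc n"
        let ?y = "euler (phase_field \<phi>) \<alpha> (h n) w i"
        have "norm ?y \<le> M * (R0 + C)"
          using e_bd[OF w, of i n] \<open>i < Suc n\<close> by (simp add: F_def)
        then have "\<bar>fst ?y\<bar> \<le> M * (R0 + C)"
          using abs_fst_snd_le_norm(1)[of ?y] by linarith
        then have "\<epsilon> * \<bar>fst ?y\<bar> \<le> \<epsilon> * (M * (R0 + C))"
          using \<epsilon>(1) by (intro mult_left_mono) auto
        then show "\<bar>\<phi> (\<alpha> + real i * h n) (fst ?y) (snd ?y)\<bar> \<le> \<rho>"
          using C(2)[of "\<alpha> + real i * h n" "fst ?y" "snd ?y"] by (simp add: \<rho>_def)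
      qed (use h0[of n] hT[of n] in auto)
      then have *: "\<bar>snd (e w) - snd w\<bar> \<le> T * \<rho>"
        "\<bar>fst (e w) - fst w - T * snd w\<bar> \<le> T * (T * \<rho>)"
        unfolding hT by auto
      have V: "\<bar>V w\<bar> \<le> \<bar>\<kappa>\<bar> * (T * \<rho>)"
        unfolding V_def abs_mult by (intro mult_left_mono * abs_ge_zero)
      have "\<bar>U w\<bar> \<le> \<bar>\<kappa>\<bar> * (T * \<bar>V w\<bar> + \<bar>fst (e w) - fst w - T * snd w\<bar>)"
        unfolding U_def abs_mult using T abs_triangle_ineq[of "T * V w"]
        by (intro mult_left_mono abs_ge_zero) (simp add: abs_mult)
      also have "\<dots> \<le> \<bar>\<kappa>\<bar> * (T * (\<bar>\<kappa>\<bar> * (T * \<rho>)) + T * (T * \<rho>))"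
        using T V * by (intro mult_left_mono add_mono) auto
      finally have "\<bar>U w\<bar> + \<bar>V w\<bar> \<le> D * \<rho>"
        using V by (simp add: D_def algebra_simps)
      then show "(U w, V w) \<in> cball 0 R0"
        using abs_fst_snd_le_norm(3)[of "(U w, V w)"] D\<rho> by simp
    qed
    ultimately obtain w where w: "w \<in> cball 0 R0" "(U w, V w) = w"
      using brouwer_ball[OF R0] by blast
    have \<kappa>: "x = \<mu> * y" if "x = \<kappa> * (y - x)" for x y
    proof -
      have "x * (1 - \<mu>) = \<mu> * (y - x)"
        using that \<mu> by (simp add: \<kappa>_def field_simps)
      then show ?thesis by (simp add: algebra_simps)
    qed
    have "snd w = \<mu> * snd (e w)"
      using w(2) by (intro \<kappa>) (metis V_def snd_conv)
    moreover have "fst w = \<mu> * fst (e w)"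
    proof (rule \<kappa>)
      have "V w = snd w" "U w = fst w" using w(2) by (metis snd_conv, metis fst_conv)
      then show "fst w = \<kappa> * (fst (e w) - fst w)" unfolding U_def by simp
    qed
    ultimately show ?thesis
      using w(1) by (intro exI[of _ w]) (simp add: prod_eq_iff e_def del: euler.simps)
  qed
  then obtain w where w: "\<And>n. norm (w n) \<le> R0"
    "\<And>n. w n = \<mu> *\<^sub>R euler F \<alpha> (h n) (w n) (Suc n)"
    by metis
  have w_bd: "norm (euler F \<alpha> (T / Suc n) (w n) i) \<le> M * (R0 + C)" if "i \<le> Suc n" for n i
    using e_bd[OF w(1) that] by (simp add: h_def)
  have F_bd': "norm (F t y) \<le> 2 * (M * (R0 + C)) + C" if "norm y \<le> M * (R0 + C)" for t y
    using F_bd[of t y] that by linarith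
  show ?thesis
  proof (rule euler_limit[OF T w_bd F_bd'])
    fix W r
    assume W: "continuous_on {\<alpha>..\<alpha> + T} W" "strict_mono (r :: nat \<Rightarrow> nat)"
      "(\<lambda>n. w (r n)) \<longlonglongrightarrow> W \<alpha>"
      "(\<lambda>n. euler F \<alpha> (T / Suc (r n)) (w (r n)) (Suc (r n))) \<longlonglongrightarrow> W (\<alpha> + T)"
      "\<And>t. \<lbrakk>\<alpha> < t; t < \<alpha> + T; isCont (\<lambda>(t, y). F t y) (t, W t)\<rbrakk>
        \<Longrightarrow> (W has_vector_derivative F t (W t)) (at t)"
    have "(\<lambda>n. w (r n)) \<longlonglongrightarrow> \<mu> *\<^sub>R W (\<alpha> + T)"
      using tendsto_scaleR[OF tendsto_const W(4), of \<mu>] w(2) by (simp add: h_def)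
    then have bc: "W \<alpha> = \<mu> *\<^sub>R W (\<alpha> + T)"
      using W(3) LIMSEQ_unique by blast
    show ?thesis
    proof (rule exI[of _ "\<lambda>t. fst (W t)"], rule exI[of _ "\<lambda>t. snd (W t)"],
        intro conjI ballI impI)
      fix t assume t: "t \<in> {\<alpha><..<\<alpha> + T}"
        and c: "isCont (\<lambda>(t, u, v). \<phi> t u v) (t, fst (W t), snd (W t))"
      have c': "isCont (\<lambda>z. \<phi> (fst z) (fst (snd z)) (snd (snd z))) (t, W t)"
        using c by (simp add: case_prod_unfold)
      have "isCont (\<lambda>(t, y). F t y) (t, W t)"
        unfolding F_def phase_field_def case_prod_unfold by (intro continuous_intros c')
      then have d: "(W has_vector_derivative F t (W t)) (at t)"
        using W(5) t by simp
      show "((\<lambda>t. fst (W t)) has_real_derivative snd (W t)) (at t)"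
           "((\<lambda>t. snd (W t)) has_real_derivative \<phi> t (fst (W t)) (snd (W t))) (at t)"
        using bounded_linear.has_vector_derivative[OF bounded_linear_fst d]
          bounded_linear.has_vector_derivative[OF bounded_linear_snd d]
        by (simp_all add: F_def phase_field_def has_real_derivative_iff_has_vector_derivative)
    qed (use bc W(1) in \<open>auto intro: continuous_intros\<close>)
  qed
qed

section \<open>Periodic functions with impulses\<close>

lemma periodic_shift_int:
  fixes f :: "real \<Rightarrow> 'a"
  assumes "\<And>t. f (t + T) = f t"
  shows "f (t + T * of_int m) = f t"
proof -
  have nat: "f (t + T * real n) = f t" for t n
  proof (induction n)
    case (Suc n)
    then show ?case using assms[of "t + T * real n"] by (simp add: algebra_simps)
  qed simp
  show ?thesis
  proof (cases "m \<ge> 0")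
    case True
    then show ?thesis using nat[of t "nat m"] by simp
  next
    case False
    then show ?thesis using nat[of "t + T * of_int m" "nat (- m)"] by simp
  qed
qed

text \<open>The values on the half-open period \<open>{c<..c + T}\<close> are repeated: at an impulse time a solution
takes its left limit, so the right end point belongs to the period and the left one does not.\<close>

definition periodize :: "real \<Rightarrow> real \<Rightarrow> (real \<Rightarrow> 'a) \<Rightarrow> real \<Rightarrow> 'a" where
  "periodize c T f t = f (t - T * of_int (\<lceil>(t - c) / T\<rceil> - 1))"

lemma periodize_shift: "T > 0 \<Longrightarrow> periodize c T f (t + T) = periodize c T f t"
proof -
  assume "T > 0"
  then have "(t + T - c) / T = (t - c) / T + 1" by (simp add: field_simps)
  then have "\<lceil>(t + T - c) / T\<rceil> = \<lceil>(t - c) / T\<rceil> + 1" by linarith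
  then show ?thesis by (simp add: periodize_def algebra_simps)
qed

lemma periodize_eq: "\<lbrakk>c < t; t \<le> c + T\<rbrakk> \<Longrightarrow> periodize c T f t = f t"
proof -
  assume "c < t" "t \<le> c + T"
  then have "\<lceil>(t - c) / T\<rceil> = 1" by (simp add: ceiling_eq_iff field_simps)
  then show ?thesis by (simp add: periodize_def)
qed

lemma period_translate:
  fixes c t T :: real
  assumes "T > 0"
  obtains m :: int where "c < t + T * of_int m" "t + T * of_int m \<le> c + T"
proof
  let ?q = "(t - c) / T"
  have "of_int \<lceil>?q\<rceil> - 1 < ?q" "?q \<le> of_int \<lceil>?q\<rceil>" by linarith+
  then have "T * (of_int \<lceil>?q\<rceil> - 1) < T * ?q" "T * ?q \<le> T * of_int \<lceil>?q\<rceil>"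
    using assms by (simp_all only: mult_less_cancel_left_pos mult_le_cancel_left_pos)
  moreover have "T * ?q = t - c" using assms by simp
  ultimately show "c < t + T * of_int (1 - \<lceil>?q\<rceil>)" "t + T * of_int (1 - \<lceil>?q\<rceil>) \<le> c + T"
    by (simp_all add: algebra_simps)
qed

lemma tendsto_at_left_translate:
  fixes f :: "real \<Rightarrow> real"
  assumes "\<And>t. f (t + d) = f t" and "(f \<longlongrightarrow> l) (at_left s)"
  shows "(f \<longlongrightarrow> l) (at_left (s + d))"
proof -
  have "filterlim (\<lambda>t. t - d) (at_left s) (at_left (s + d))"
    using filtermap_at_left_shift[of d "s + d"] by (simp add: filterlim_def)
  from filterlim_compose[OF assms(2) this] show ?thesis
    using assms(1)[of "t - d" for t] by simp
qed

lemma tendsto_at_right_translate: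
  fixes f :: "real \<Rightarrow> real"
  assumes "\<And>t. f (t + d) = f t" and "(f \<longlongrightarrow> l) (at_right s)"
  shows "(f \<longlongrightarrow> l) (at_right (s + d))"
proof -
  have "filterlim (\<lambda>t. t - d) (at_right s) (at_right (s + d))"
    using filtermap_at_right_shift[of d "s + d"] by (simp add: filterlim_def)
  from filterlim_compose[OF assms(2) this] show ?thesis
    using assms(1)[of "t - d" for t] by simp
qed

lemma linear_impulse_translate:
  assumes "\<And>t. f (t + d) = f t" and "linear_impulse a f s"
  shows "linear_impulse a f (s + d)"
  using assms(2) tendsto_at_left_translate[where f = f, OF assms(1)]
    tendsto_at_right_translate[where f = f, OF assms(1)] assms(1)[of s]
  unfolding linear_impulse_def by metis

text \<open>Multiplying a continuous function by \<open>1 + a\<close> after each breakpoint produces the impulses. At the last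
breakpoint the next piece is the first piece of the following period, and the factor
\<open>(1 + a)\<^sup>k\<close> between the end values of \<open>q\<close> takes the place of the jump of the factor.\<close>

lemma linear_impulse_at_breakpoint:
  fixes \<sigma> :: "nat \<Rightarrow> real" and f q :: "real \<Rightarrow> real"
  assumes mono: "\<And>i j. \<lbrakk>i < j; j \<le> k\<rbrakk> \<Longrightarrow> \<sigma> i < \<sigma> j"
    and piece: "\<And>j t. \<lbrakk>j < k; \<sigma> j < t; t \<le> \<sigma> (Suc j)\<rbrakk> \<Longrightarrow> f t = (1 + a) ^ j * q t"
    and q: "continuous_on {\<sigma> 0..\<sigma> k} q" "q (\<sigma> 0) = (1 + a) ^ k * q (\<sigma> k)"
    and period: "\<And>t. f (t + (\<sigma> k - \<sigma> 0)) = f t"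
    and "j < k"
  shows "linear_impulse a f (\<sigma> (Suc j))"
proof -
  have mono_le: "\<sigma> i \<le> \<sigma> j" if "i \<le> j" "j \<le> k" for i j
    using mono[of i j] that by (cases "i = j") auto
  have step: "\<sigma> i < \<sigma> (Suc i)" if "i < k" for i
    using mono that by simp
  have q_cont: "continuous_on {\<sigma> i..\<sigma> (Suc i)} (\<lambda>t. (1 + a) ^ i * q t)" if "i < k" for i
    using mono_le[of 0 i] mono_le[of "Suc i" k] that
    by (intro continuous_intros continuous_on_subset[OF q(1)]) auto
  have left: "(f \<longlongrightarrow> (1 + a) ^ i * q (\<sigma> (Suc i))) (at_left (\<sigma> (Suc i)))" if "i < k" for i
    using continuous_on_Icc_at_leftD[OF q_cont[OF that] step[OF that]]
    by (rule Lim_transform_eventually, intro eventually_at_leftI[OF _ step[OF that]])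
      (simp add: piece[OF that] less_imp_le)
  have right: "(f \<longlongrightarrow> (1 + a) ^ i * q (\<sigma> i)) (at_right (\<sigma> i))" if "i < k" for i
    using continuous_on_Icc_at_rightD[OF q_cont[OF that] step[OF that]]
    by (rule Lim_transform_eventually, intro eventually_at_rightI[OF _ step[OF that]])
      (simp add: piece[OF that] less_imp_le)
  have "(f \<longlongrightarrow> (1 + a) ^ Suc j * q (\<sigma> (Suc j))) (at_right (\<sigma> (Suc j)))"
  proof (cases "Suc j < k")
    case True
    then show ?thesis by (rule right)
  next
    case False
    then have k: "k = Suc j" using \<open>j < k\<close> by simp
    have "(f \<longlongrightarrow> q (\<sigma> 0)) (at_right (\<sigma> 0))"
      using right[of 0] \<open>j < k\<close> by simp
    from tendsto_at_right_translate[where f = f, OF period this] show ?thesis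
      using q(2) k by simp
  qed
  moreover have "f (\<sigma> (Suc j)) = (1 + a) ^ j * q (\<sigma> (Suc j))"
    using piece[of j "\<sigma> (Suc j)"] mono[of j "Suc j"] \<open>j < k\<close> by simp
  ultimately show ?thesis
    using left[OF \<open>j < k\<close>] unfolding linear_impulse_def
    by (intro exI[of _ "(1 + a) ^ j * q (\<sigma> (Suc j))"] exI[of _ "(1 + a) ^ Suc j * q (\<sigma> (Suc j))"])
      (simp add: algebra_simps)
qed

lemma breakpoints_cover:
  fixes \<sigma> :: "nat \<Rightarrow> real"
  assumes "\<sigma> 0 < t" "t \<le> \<sigma> k"
  obtains j where "j < k" "\<sigma> j < t" "t \<le> \<sigma> (Suc j)"
proof -
  have "\<exists>j<k. \<sigma> j < t \<and> t \<le> \<sigma> (Suc j)"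
    using assms(2)
  proof (induction k)
    case 0
    then show ?case using assms(1) by simp
  next
    case (Suc k)
    then show ?case by (cases "t \<le> \<sigma> k") (auto intro: less_SucI)
  qed
  then show ?thesis using that by blast
qed

lemma card_breakpoints_below:
  fixes \<sigma> :: "nat \<Rightarrow> real"
  assumes mono: "\<And>i j. \<lbrakk>i < j; j \<le> k\<rbrakk> \<Longrightarrow> \<sigma> i < \<sigma> j"
    and "j < k" "\<sigma> j < t" "t \<le> \<sigma> (Suc j)"
  shows "card {i \<in> {1..k}. \<sigma> i < t} = j"
proof -
  have "\<sigma> i < t \<longleftrightarrow> i \<le> j" if "i \<le> k" for i
    using mono[of i j] mono[of "Suc j" i] assms(2-) that
    by (cases "i < j"; cases "i = j"; cases "i = Suc j") auto
  then have "{i \<in> {1..k}. \<sigma> i < t} = {1..j}"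
    using \<open>j < k\<close> by auto
  then show ?thesis by simp
qed

section \<open>The impulsive equation\<close>

lemma sublinear_bound:
  fixes g :: "real \<Rightarrow> real"
  assumes g: "continuous_on UNIV g" and lim: "((\<lambda>x. g x / x) \<longlongrightarrow> 0) at_infinity" and "\<epsilon> > 0"
  obtains C where "C \<ge> 0" "\<And>x. \<bar>g x\<bar> \<le> \<epsilon> * \<bar>x\<bar> + C"
proof -
  obtain B where B: "\<And>x. B \<le> \<bar>x\<bar> \<Longrightarrow> \<bar>g x / x\<bar> < \<epsilon>"
    using tendstoD[OF lim \<open>\<epsilon> > 0\<close>] by (auto simp: eventually_at_infinity dist_real_def)
  have "compact (g ` cball 0 \<bar>B\<bar>)"
    by (intro compact_continuous_image continuous_on_subset[OF g]) auto
  then obtain C where C: "\<And>x. x \<in> cball 0 \<bar>B\<bar> \<Longrightarrow> \<bar>g x\<bar> \<le> C"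
    using compact_imp_bounded bounded_iff by (metis imageI real_norm_def)
  have "C \<ge> 0" using C[of 0] by simp
  moreover have "\<bar>g x\<bar> \<le> \<epsilon> * \<bar>x\<bar> + C" for x
  proof (cases "\<bar>x\<bar> \<le> \<bar>B\<bar>")
    case True
    then have "\<bar>g x\<bar> \<le> C" using C[of x] by simp
    then show ?thesis using \<open>\<epsilon> > 0\<close> by (simp add: add_increasing)
  next
    case False
    then have "\<bar>x\<bar> > 0" "\<bar>g x / x\<bar> < \<epsilon>" using B[of x] by auto
    then have "\<bar>g x\<bar> < \<epsilon> * \<bar>x\<bar>" by (simp add: abs_divide pos_divide_less_eq)
    then show ?thesis using \<open>C \<ge> 0\<close> by simp
  qed
  ultimately show ?thesis using that by blast
qed

theorem theorem2p1:
  fixes k :: nat and \<tau> :: "int \<Rightarrow> real" and a :: real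
    and p :: "real \<Rightarrow> real \<Rightarrow> real \<Rightarrow> real" and g :: "real \<Rightarrow> real"
  assumes "k \<ge> 1"
    and "0 \<le> \<tau> 1" and "strict_mono_on {1..int k} \<tau>" and "\<tau> (int k) < 2 * pi"
    and "\<And>j. \<tau> (j + int k) = \<tau> j + 2 * pi"
    and "a > 0"
    and "bounded (range (\<lambda>(t, x, y). p t x y))"
    and "continuous_on UNIV (\<lambda>(t, x, y). p t x y)"
    and "\<And>t x y. p (t + 2 * pi) x y = p t x y"
    and "local_lipschitz (UNIV :: real set) UNIV (\<lambda>_. g)"
    and "cond_g0 g"
    and "cond_g1 g"
  shows "\<exists>x. impulsive_solution \<tau> a g p x \<and> (\<forall>t. x (t + 2 * pi) = x t)"
proof -
  note \<tau>_period = assms(5) and p_cont = assms(8) and p_period = assms(9)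
  \<comment> \<open>The period begins at \<open>\<tau> 0 = \<tau> k - 2 * pi < 0\<close>, so its end points are impulse times.\<close>
  define \<sigma> where "\<sigma> i = \<tau> (int i)" for i :: nat
  have \<sigma>k: "\<sigma> k = \<sigma> 0 + 2 * pi"
    using \<tau>_period[of 0] by (simp add: \<sigma>_def)
  have mono: "\<sigma> i < \<sigma> j" if "i < j" "j \<le> k" for i j
  proof (cases "i = 0")
    case True
    have "\<sigma> 0 < \<tau> 1"
      using \<sigma>k assms(2,4) by (simp add: \<sigma>_def)
    also have "\<tau> 1 \<le> \<sigma> j"
      using strict_mono_on_leD[OF assms(3), of 1 "int j"] that by (auto simp: \<sigma>_def)
    finally show ?thesis using True by simp
  next
    case False
    then show ?thesis
      unfolding \<sigma>_def using that by (intro strict_mono_onD[OF assms(3)]) auto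
  qed
  define b where "b t = (1 + a) ^ card {i \<in> {1..k}. \<sigma> i < t}" for t
  have b1: "b t \<ge> 1" for t
    using \<open>a > 0\<close> by (simp add: b_def one_le_power)
  have b_eq: "b t = (1 + a) ^ j" if "j < k" "\<sigma> j < t" "t \<le> \<sigma> (Suc j)" for j t
    unfolding b_def using card_breakpoints_below[OF mono that] by simp
  define \<phi> where "\<phi> t u v = (p t (b t * u) (b t * v) - g (b t * u)) / b t" for t u v
  have g_cont: "continuous_on UNIV g"
    using local_lipschitz_continuous_on[OF assms(10)] by simp
  have \<phi>_cont: "continuous_on S (\<lambda>z. (p (fst z) (\<beta> * fst (snd z)) (\<beta> * snd (snd z))
      - g (\<beta> * fst (snd z))) / \<beta>)" if "\<beta> > 0" for \<beta> :: real and S :: "(real \<times> real \<times> real) set"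
  proof -
    have "continuous_on S (\<lambda>z. p (fst z) (\<beta> * fst (snd z)) (\<beta> * snd (snd z)))"
      using continuous_on_compose2[OF p_cont, of S "\<lambda>z. (fst z, \<beta> * fst (snd z), \<beta> * snd (snd z))"]
      by (simp add: continuous_intros)
    moreover have "continuous_on S (\<lambda>z. g (\<beta> * fst (snd z)))"
      by (rule continuous_on_compose2[OF g_cont]) (auto intro!: continuous_intros)
    ultimately show ?thesis
      using that by (intro continuous_intros) auto
  qed
  have "continuous_on UNIV (\<lambda>w. \<phi> t (fst w) (snd w))" for t
  proof -
    have "b t > 0" using b1[of t] by simp
    moreover have "continuous_on UNIV (Pair t :: real \<times> real \<Rightarrow> _)"
      by (intro continuous_on_Pair continuous_intros)
    ultimately show ?thesis
      using continuous_on_compose2[OF \<phi>_cont[of "b t" UNIV], of UNIV "Pair t"]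
      by (simp add: \<phi>_def)
  qed
  moreover have "\<exists>C. \<forall>t u v. \<bar>\<phi> t u v\<bar> \<le> \<epsilon> * \<bar>u\<bar> + C" if \<epsilon>: "\<epsilon> > 0" for \<epsilon>
  proof -
    obtain A where A: "\<And>t x y. \<bar>p t x y\<bar> \<le> A"
      using assms(7) by (auto simp: bounded_iff)
    obtain C where C: "C \<ge> 0" "\<And>x. \<bar>g x\<bar> \<le> \<epsilon> * \<bar>x\<bar> + C"
      using sublinear_bound[OF g_cont _ \<epsilon>] assms(11) unfolding cond_g0_def by blast
    have A0: "A \<ge> 0" using A[of 0 0 0] by simp
    have "\<bar>\<phi> t u v\<bar> \<le> \<epsilon> * \<bar>u\<bar> + (A + C)" for t u v
    proof -
      have b0: "b t > 0" using b1[of t] by simp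
      have "\<bar>p t (b t * u) (b t * v) - g (b t * u)\<bar> \<le> A + (\<epsilon> * \<bar>b t * u\<bar> + C)"
        using A[of t "b t * u" "b t * v"] C(2)[of "b t * u"] by linarith
      also have "\<dots> = b t * (\<epsilon> * \<bar>u\<bar>) + 1 * (A + C)"
        using b0 by (simp add: abs_mult algebra_simps)
      \<comment> \<open>Dividing by \<open>b t \<ge> 1\<close> preserves the factor \<open>\<epsilon>\<close>, since \<open>g\<close> is evaluated at \<open>b t * u\<close>.\<close>
      also have "\<dots> \<le> b t * (\<epsilon> * \<bar>u\<bar>) + b t * (A + C)"
        using b1[of t] A0 C(1) by (intro add_left_mono mult_right_mono) auto
      finally show ?thesis
        using b0 by (simp add: \<phi>_def abs_divide pos_divide_le_eq algebra_simps)
    qed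
    then show ?thesis by blast
  qed
  moreover have "2 * pi > 0" "(1 + a) ^ k \<noteq> 1"
    using \<open>a > 0\<close> \<open>k \<ge> 1\<close> one_less_power[of "1 + a" k] by (simp_all add: less_imp_neq[symmetric])
  ultimately obtain u v where uv: "continuous_on {\<sigma> 0..\<sigma> k} u" "continuous_on {\<sigma> 0..\<sigma> k} v"
    "u (\<sigma> 0) = (1 + a) ^ k * u (\<sigma> k)" "v (\<sigma> 0) = (1 + a) ^ k * v (\<sigma> k)"
    and deriv: "\<forall>t\<in>{\<sigma> 0<..<\<sigma> k}. isCont (\<lambda>(t, u, v). \<phi> t u v) (t, u t, v t) \<longrightarrow>
      (u has_real_derivative v t) (at t) \<and> (v has_real_derivative \<phi> t (u t) (v t)) (at t)"
    unfolding \<sigma>k using sublinear_bvp[of "2 * pi" "(1 + a) ^ k" \<phi> "\<sigma> 0"] by blast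
  define x where "x = periodize (\<sigma> 0) (2 * pi) (\<lambda>t. b t * u t)"
  define y where "y = periodize (\<sigma> 0) (2 * pi) (\<lambda>t. b t * v t)"
  have x_period: "x (t + 2 * pi) = x t" and y_period: "y (t + 2 * pi) = y t" for t
    by (simp_all add: x_def y_def periodize_shift)
  have x_eq: "x t = (1 + a) ^ j * u t" and y_eq: "y t = (1 + a) ^ j * v t"
    if "j < k" "\<sigma> j < t" "t \<le> \<sigma> (Suc j)" for j t
  proof -
    have "\<sigma> 0 \<le> \<sigma> j" "\<sigma> (Suc j) \<le> \<sigma> k"
      using mono[of 0 j] mono[of "Suc j" k] that(1) by (cases "j = 0"; cases "Suc j = k"; simp)+
    then have "\<sigma> 0 < t" "t \<le> \<sigma> 0 + 2 * pi"
      using that \<sigma>k by auto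
    then show "x t = (1 + a) ^ j * u t" "y t = (1 + a) ^ j * v t"
      using b_eq[OF that] by (simp_all add: x_def y_def periodize_eq)
  qed
  have smooth: "(x has_real_derivative y t) (at t) \<and>
      (y has_real_derivative p t (x t) (y t) - g (x t)) (at t)"
    if "j < k" "\<sigma> j < t" "t < \<sigma> (Suc j)" for j t
  proof -
    let ?I = "{\<sigma> j<..<\<sigma> (Suc j)}" and ?\<beta> = "(1 + a) ^ j"
    have "\<sigma> 0 \<le> \<sigma> j" "\<sigma> (Suc j) \<le> \<sigma> k"
      using mono[of 0 j] mono[of "Suc j" k] that(1) by (cases "j = 0"; cases "Suc j = k"; simp)+
    then have t: "\<sigma> 0 < t" "t < \<sigma> k" using that by auto
    have tI: "t \<in> ?I" using that by simp
    have \<beta>: "?\<beta> > 0" using \<open>a > 0\<close> by simp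
    have "continuous_on (?I \<times> UNIV) (\<lambda>(t, u, v). \<phi> t u v)"
      using b_eq[OF \<open>j < k\<close>]
      by (intro continuous_on_eq[OF \<phi>_cont[OF \<beta>]]) (auto simp: \<phi>_def)
    moreover have "open (?I \<times> (UNIV :: (real \<times> real) set))"
      by (intro open_Times) auto
    ultimately have "isCont (\<lambda>(t, u, v). \<phi> t u v) (t, u t, v t)"
      using tI by (simp add: continuous_on_eq_continuous_at)
    then have d: "(u has_real_derivative v t) (at t)" "(v has_real_derivative \<phi> t (u t) (v t)) (at t)"
      using deriv t by auto
    have dx: "(x has_real_derivative ?\<beta> * v t) (at t)"
      by (rule has_field_derivative_transform_within_open[OF DERIV_cmult[OF d(1)] _ tI])
        (use x_eq[OF \<open>j < k\<close>] in auto)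
    have dy: "(y has_real_derivative ?\<beta> * \<phi> t (u t) (v t)) (at t)"
      by (rule has_field_derivative_transform_within_open[OF DERIV_cmult[OF d(2)] _ tI])
        (use y_eq[OF \<open>j < k\<close>] in auto)
    have "?\<beta> * \<phi> t (u t) (v t) = p t (x t) (y t) - g (x t)"
      using \<beta> \<open>a > 0\<close> x_eq[of j t] y_eq[of j t] b_eq[of j t] that by (simp add: \<phi>_def)
    with dx dy show ?thesis
      using y_eq[of j t] that by simp
  qed
  have impulse: "linear_impulse a x (\<sigma> (Suc j))" "linear_impulse a y (\<sigma> (Suc j))" if "j < k" for j
    using linear_impulse_at_breakpoint[where f = x, OF mono x_eq uv(1,3) _ that]
      linear_impulse_at_breakpoint[where f = y, OF mono y_eq uv(2,4) _ that]
      x_period y_period \<sigma>k by simp_all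
  have \<tau>_shift: "\<tau> (j + int k * m) = \<tau> j + 2 * pi * of_int m" for j m
  proof (induction m rule: int_induct[where k = 0])
    case (step1 i)
    then show ?case
      using \<tau>_period[of "j + int k * i"] by (simp add: algebra_simps)
  next
    case (step2 i)
    then show ?case
      using \<tau>_period[of "j + int k * (i - 1)"] by (simp add: algebra_simps)
  qed simp
  have "impulsive_solution \<tau> a g p x"
    unfolding impulsive_solution_def
  proof (intro exI[of _ y] conjI allI impI)
    fix t assume t: "t \<notin> range \<tau>"
    obtain m where m: "\<sigma> 0 < t + 2 * pi * of_int m" "t + 2 * pi * of_int m \<le> \<sigma> 0 + 2 * pi"
      using period_translate[of "2 * pi" "\<sigma> 0" t] by auto
    let ?s = "t + 2 * pi * of_int m"
    obtain j where j: "j < k" "\<sigma> j < ?s" "?s \<le> \<sigma> (Suc j)"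
      using breakpoints_cover[of \<sigma> ?s k] m \<sigma>k by auto
    have "?s \<noteq> \<sigma> (Suc j)"
    proof
      assume "?s = \<sigma> (Suc j)"
      then have "t = \<tau> (int (Suc j) + int k * (- m))"
        unfolding \<tau>_shift by (simp add: \<sigma>_def)
      then show False using t by blast
    qed
    then have s: "(x has_real_derivative y ?s) (at ?s)"
      "(y has_real_derivative p ?s (x ?s) (y ?s) - g (x ?s)) (at ?s)"
      using smooth[of j ?s] j by auto
    have "x (r + 2 * pi * of_int m) = x r" "y (r + 2 * pi * of_int m) = y r"
      "p (r + 2 * pi * of_int m) = p r" for r
      by (rule periodic_shift_int; use x_period y_period p_period in blast)+
    then have "(x has_real_derivative y t) (at t)"
      "(y has_real_derivative p t (x t) (y t) - g (x t)) (at t)"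
      using s unfolding DERIV_shift by simp_all
    then show "(x has_real_derivative y t) (at t)"
      "\<exists>y'. (y has_real_derivative y') (at t) \<and> y' + g (x t) = p t (x t) (y t)"
      by auto
  next
    fix j :: int
    \<comment> \<open>The residues are taken in \<open>1..k\<close>, because the right end point belongs to the period.\<close>
    define m where "m = (j - 1) div int k"
    define i where "i = nat ((j - 1) mod int k)"
    have i: "i < k" "j = int (Suc i) + int k * m"
      using \<open>k \<ge> 1\<close> by (simp_all add: i_def m_def nat_less_iff algebra_simps)
    have \<tau>j: "\<tau> j = \<sigma> (Suc i) + 2 * pi * of_int m"
      unfolding i(2) \<tau>_shift by (simp add: \<sigma>_def)
    show "linear_impulse a x (\<tau> j)" "linear_impulse a y (\<tau> j)"
      unfolding \<tau>j by (rule linear_impulse_translate impulse i periodic_shift_int x_period y_period)+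
  qed
  then show ?thesis using x_period by blast
qed

end
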